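(* Let $K,U,N,N_{RF}$ be positive integers, let $G=(V,E)$ be an interference graph (finite, simple, undirected) with node set $V=\{v_{k,u}:1\le k\le K,\ 1\le u\le U\}$, and let requirements $d_{k,u}$ be integers with $0\le d_{k,u}\le N$ and $\sum_{u=1}^U d_{k,u}=N_{RF}N$ for every $k$. Let $n_0^*$ be the optimal value of problem P1 with interference graph $G$, and let $\tilde n_0$ be the value produced by the lower-bound algorithm (both described in the context). Then $n_0^*\ge\tilde n_0$.
   Context: Setting: node $v_{k,u}$ represents the $u$th user of cell $k$; the edge joining $v_{k,u}$ and $v_{k',u'}$ is denoted $e_{(k,u),(k',u')}$. There are $N$ time slots and each cell's base station has $N_{RF}$ RF chains. A scheduling is a family of matrices $\{\boldsymbol S^k\}_{k=1}^K$, $\boldsymbol S^k=(s^k_{r,n})$ with $1\le r\le N_{RF}$, $1\le n\le N$; $s^k_{r,n}=u\neq0$ means user $u$ of cell $k$ is served by RF chain $r$ in slot $n$, and $s^k_{r,n}=0$ means that no user is. Write $\delta(x,y)=1$ if $x=y$ and $0$ otherwise. Problem P1: minimize over $\{\boldsymbol S^k\}_{k=1}^K$ the quantity $n_0=\sum_{(k,u)}(d_{k,u}-\hat d_{k,u})$ subject to (a) $s^k_{r,n}\in\{0,1,\dots,U\}$ for all $k,r,n$; (b) $\hat d_{k,u}=\sum_{(r,n)}\delta(s^k_{r,n},u)\le d_{k,u}$ for all $k$ and $1\le u\le U$; (c) $\delta(s^k_{r,n},s^k_{r',n})=\delta(r,r')$ whenever $s^k_{r,n}s^k_{r',n}\neq0$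 (a user is not served by two RF chains simultaneously); (d) $e_{(k,s^k_{r,n}),(k',s^{k'}_{r',n})}\notin E$ whenever $s^k_{r,n}s^{k'}_{r',n}\ne0$, for all $k,r,k',r',n$ (adjacent users are not served in the same slot). Lower-bound algorithm: set $\tilde n_0=0$. Repeat: search the current graph $G$ for a local-maximal clique $G_c=(V_c,E_c)$ (a clique not contained in any other clique of the current graph) with $\sum_{v_{k_q,u_q}\in V_c}d_{k_q,u_q}>N$; if one is found, increase $\tilde n_0$ by $\sum_{v_{k_q,u_q}\in V_c}d_{k_q,u_q}-N$ and remove $G_c$ (its nodes and all edges incident with them) from $G$. Stop when no such clique can be found in the current graph. The choice of clique at each step is arbitrary. *)

theory Defs
  imports "HOL-Library.Ramsey"
begin

text \<open>
  The node \<open>v\<^bsub>k,u\<^esub>\<close> is the pair \<open>(k, u)\<close>. An undirected edge is the two-element set of its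
  end nodes, so \<open>E \<subseteq> [V]\<^bsup>2\<^esup>\<close> says that \<open>(V, E)\<close> is a simple graph, and cliques
  are given by their node sets. A scheduling is a function \<open>s\<close> with \<open>s k r n\<close> standing for
  \<open>s\<^sup>k\<^bsub>r,n\<^esub>\<close>; only its values at indices in range matter.
\<close>

definition nodes :: "nat \<Rightarrow> nat \<Rightarrow> (nat \<times> nat) set" where
  "nodes K U = {1..K} \<times> {1..U}"

definition delta :: "nat \<Rightarrow> nat \<Rightarrow> nat" where
  "delta x y = (if x = y then 1 else 0)"

type_synonym scheduling = "nat \<Rightarrow> nat \<Rightarrow> nat \<Rightarrow> nat"

definition served :: "nat \<Rightarrow> nat \<Rightarrow> scheduling \<Rightarrow> nat \<Rightarrow> nat \<Rightarrow> nat" where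
  "served N NRF s k u = (\<Sum>(r, n) \<in> {1..NRF} \<times> {1..N}. delta (s k r n) u)"

definition feasible ::
  "nat \<Rightarrow> nat \<Rightarrow> nat \<Rightarrow> nat \<Rightarrow> (nat \<times> nat) set set \<Rightarrow> (nat \<Rightarrow> nat \<Rightarrow> nat) \<Rightarrow> scheduling \<Rightarrow> bool"
  where
  "feasible K U N NRF E d s \<longleftrightarrow>
     (\<forall>k\<in>{1..K}. \<forall>r\<in>{1..NRF}. \<forall>n\<in>{1..N}. s k r n \<in> {0..U}) \<and>
     (\<forall>k\<in>{1..K}. \<forall>u\<in>{1..U}. served N NRF s k u \<le> d k u) \<and>
     (\<forall>k\<in>{1..K}. \<forall>r\<in>{1..NRF}. \<forall>r'\<in>{1..NRF}. \<forall>n\<in>{1..N}.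
        s k r n * s k r' n \<noteq> 0 \<longrightarrow> delta (s k r n) (s k r' n) = delta r r') \<and>
     (\<forall>k\<in>{1..K}. \<forall>k'\<in>{1..K}. \<forall>r\<in>{1..NRF}. \<forall>r'\<in>{1..NRF}. \<forall>n\<in>{1..N}.
        s k r n * s k' r' n \<noteq> 0 \<longrightarrow> {(k, s k r n), (k', s k' r' n)} \<notin> E)"

definition objective ::
  "nat \<Rightarrow> nat \<Rightarrow> nat \<Rightarrow> nat \<Rightarrow> (nat \<Rightarrow> nat \<Rightarrow> nat) \<Rightarrow> scheduling \<Rightarrow> int" where
  "objective K U N NRF d s = (\<Sum>(k, u) \<in> nodes K U. int (d k u) - int (served N NRF s k u))"

definition optimal_value ::
  "nat \<Rightarrow> nat \<Rightarrow> nat \<Rightarrow> nat \<Rightarrow> (nat \<times> nat) set set \<Rightarrow> (nat \<Rightarrow> nat \<Rightarrow> nat) \<Rightarrow> int" where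
  "optimal_value K U N NRF E d =
     Min (objective K U N NRF d ` {s. feasible K U N NRF E d s})"

definition maximal_clique :: "'a set \<Rightarrow> 'a set set \<Rightarrow> 'a set \<Rightarrow> bool" where
  "maximal_clique V E C \<longleftrightarrow>
     C \<subseteq> V \<and> clique C E \<and> (\<forall>C'. C' \<subseteq> V \<and> clique C' E \<and> C \<subseteq> C' \<longrightarrow> C' = C)"

definition demand :: "(nat \<Rightarrow> nat \<Rightarrow> nat) \<Rightarrow> (nat \<times> nat) set \<Rightarrow> nat" where
  "demand d C = (\<Sum>(k, u) \<in> C. d k u)"

definition removable_clique ::
  "nat \<Rightarrow> (nat \<Rightarrow> nat \<Rightarrow> nat) \<Rightarrow> (nat \<times> nat) set \<Rightarrow> (nat \<times> nat) set set \<Rightarrow> (nat \<times> nat) set \<Rightarrow> bool"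
  where
  "removable_clique N d V E C \<longleftrightarrow> maximal_clique V E C \<and> demand d C > N"

text \<open>
  \<open>reachable N d V\<^sub>0 E\<^sub>0 V E t\<close>: started on the graph \<open>(V\<^sub>0, E\<^sub>0)\<close>, the lower-bound algorithm can,
  for some choice of cliques, arrive at the current graph \<open>(V, E)\<close> with current value \<open>t\<close>.
\<close>

inductive reachable ::
  "nat \<Rightarrow> (nat \<Rightarrow> nat \<Rightarrow> nat) \<Rightarrow> (nat \<times> nat) set \<Rightarrow> (nat \<times> nat) set set \<Rightarrow>
   (nat \<times> nat) set \<Rightarrow> (nat \<times> nat) set set \<Rightarrow> int \<Rightarrow> bool"
  for N d V\<^sub>0 E\<^sub>0 where
  start: "reachable N d V\<^sub>0 E\<^sub>0 V\<^sub>0 E\<^sub>0 0"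
| remove: "reachable N d V\<^sub>0 E\<^sub>0 V E t \<Longrightarrow> removable_clique N d V E C \<Longrightarrow>
    reachable N d V\<^sub>0 E\<^sub>0 (V - C) {e \<in> E. e \<inter> C = {}} (t + (int (demand d C) - int N))"

definition lower_bound_output ::
  "nat \<Rightarrow> (nat \<Rightarrow> nat \<Rightarrow> nat) \<Rightarrow> (nat \<times> nat) set \<Rightarrow> (nat \<times> nat) set set \<Rightarrow> int \<Rightarrow> bool"
  where
  "lower_bound_output N d V\<^sub>0 E\<^sub>0 t \<longleftrightarrow>
     (\<exists>V E. reachable N d V\<^sub>0 E\<^sub>0 V E t \<and> \<not> (\<exists>C. removable_clique N d V E C))"

text \<open>The minimum defining the optimal value is attained, and the algorithm always terminates.\<close>

lemma feasible_zero:
  "feasible K U N NRF E d (\<lambda>k r n. 0)"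
  by (auto simp: feasible_def served_def delta_def case_prod_unfold)

lemma finite_objective_values:
  "finite (objective K U N NRF d ` {s. feasible K U N NRF E d s})"
proof (rule finite_subset)
  show "objective K U N NRF d ` {s. feasible K U N NRF E d s}
    \<subseteq> {0..(\<Sum>(k, u) \<in> nodes K U. int (d k u))}"
  proof clarify
    fix s assume s: "feasible K U N NRF E d s"
    have "objective K U N NRF d s \<ge> 0"
      unfolding objective_def using s
      by (intro sum_nonneg) (auto simp: feasible_def nodes_def)
    moreover have "objective K U N NRF d s \<le> (\<Sum>(k, u) \<in> nodes K U. int (d k u))"
      unfolding objective_def by (intro sum_mono) auto
    ultimately show "objective K U N NRF d s \<in> {0..(\<Sum>(k, u) \<in> nodes K U. int (d k u))}"
      by simp
  qed
qed simp

lemma optimal_value_attained: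
  "\<exists>s. feasible K U N NRF E d s \<and> objective K U N NRF d s = optimal_value K U N NRF E d"
proof -
  have "optimal_value K U N NRF E d \<in> objective K U N NRF d ` {s. feasible K U N NRF E d s}"
    unfolding optimal_value_def
    using finite_objective_values feasible_zero by (intro Min_in) blast+
  then show ?thesis by auto
qed

lemma optimal_value_le:
  "feasible K U N NRF E d s \<Longrightarrow> optimal_value K U N NRF E d \<le> objective K U N NRF d s"
  unfolding optimal_value_def by (rule Min_le) (use finite_objective_values in auto)

lemma lower_bound_output_exists:
  assumes "finite V\<^sub>0"
  shows "\<exists>t. lower_bound_output N d V\<^sub>0 E\<^sub>0 t"
proof -
  have "\<exists>t'. lower_bound_output N d V\<^sub>0 E\<^sub>0 t'"
    if "finite V" "reachable N d V\<^sub>0 E\<^sub>0 V E t" for V E t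
    using that
  proof (induction "card V" arbitrary: V E t rule: less_induct)
    case less
    show ?case
    proof (cases "\<exists>C. removable_clique N d V E C")
      case True
      then obtain C where C: "removable_clique N d V E C" by blast
      then have "C \<noteq> {}" "C \<subseteq> V"
        by (auto simp: removable_clique_def demand_def maximal_clique_def)
      then have "card (V - C) < card V"
        using less.prems(1) by (intro psubset_card_mono) auto
      then show ?thesis
        using less.hyps less.prems(1) reachable.remove[OF less.prems(2) C] by blast
    next
      case False
      then show ?thesis using less.prems(2) unfolding lower_bound_output_def by blast
    qed
  qed
  then show ?thesis using assms reachable.start by blast
qed

end

theory Submission
  imports Defs
begin

text \<open>
  The nodes of a clique are pairwise adjacent, so in each slot at most one of them is served, and
  by at most one RF chain. In \<open>N\<close> slots a clique \<open>C\<close> thus receives at most \<open>N\<close> units of service, and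
  every scheduling leaves at least \<open>demand d C - N\<close> of its demand unmet. The cliques removed by the
  algorithm are disjoint cliques of the original graph, so these deficits add up.
\<close>

lemma served_eq_card:
  "served N NRF s k u = card {(r, n) \<in> {1..NRF} \<times> {1..N}. s k r n = u}"
proof -
  have "served N NRF s k u = (\<Sum>p\<in>{1..NRF} \<times> {1..N}. if s k (fst p) (snd p) = u then 1 else 0)"
    unfolding served_def delta_def by (simp add: case_prod_unfold)
  also have "\<dots> = card {p \<in> {1..NRF} \<times> {1..N}. s k (fst p) (snd p) = u}"
    by (simp flip: sum.inter_filter)
  also have "{p \<in> {1..NRF} \<times> {1..N}. s k (fst p) (snd p) = u}
      = {(r, n) \<in> {1..NRF} \<times> {1..N}. s k r n = u}"
    by auto
  finally show ?thesis .
qed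

text \<open>Distinct nodes of a clique are adjacent, so the interference constraint forces the two
  served nodes to coincide; within that single cell, the constraint against serving a user twice
  then identifies the chains.\<close>

lemma feasible_clique_slot_unique:
  assumes s: "feasible K U N NRF E d s"
    and C: "C \<subseteq> nodes K U" "clique C E"
    and n: "n \<in> {1..N}" and r: "r \<in> {1..NRF}" "r' \<in> {1..NRF}"
    and mem: "(k, s k r n) \<in> C" "(k', s k' r' n) \<in> C"
  shows "k = k'" and "r = r'"
proof -
  \<comment> \<open>Users in \<open>nodes K U\<close> are numbered from 1, so neither entry is the
    idle value 0 and both constraints apply.\<close>
  have k: "k \<in> {1..K}" "k' \<in> {1..K}" and nz: "s k r n * s k' r' n \<noteq> 0"
    using mem C(1) by (auto simp: nodes_def)
  with s n r have "{(k, s k r n), (k', s k' r' n)} \<notin> E"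
    by (auto simp: feasible_def)
  with C(2) mem have eq: "k = k'" "s k r n = s k' r' n"
    by (auto simp: clique_def)
  have "delta (s k r n) (s k r' n) = delta r r'"
    using s n r k(1) nz eq(1) unfolding feasible_def by blast
  with eq show "k = k'" "r = r'"
    by (auto simp: delta_def split: if_splits)
qed

text \<open>Total service counts incidences of a node of \<open>C\<close> with a chain and a slot;
  projecting these to the slot is injective.\<close>

lemma feasible_clique_served_le:
  assumes s: "feasible K U N NRF E d s"
    and C: "C \<subseteq> nodes K U" "clique C E"
  shows "(\<Sum>(k, u)\<in>C. served N NRF s k u) \<le> N"
proof -
  define A where "A = (\<lambda>(k, u). {(r, n) \<in> {1..NRF} \<times> {1..N}. s k r n = u})"
  have finC: "finite C"
    using C(1) by (rule finite_subset) (simp add: nodes_def)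
  have finA: "finite (A p)" for p
    by (rule finite_subset[of _ "{1..NRF} \<times> {1..N}"]) (auto simp: A_def case_prod_unfold)
  have "(\<Sum>(k, u)\<in>C. served N NRF s k u) = (\<Sum>p\<in>C. card (A p))"
    by (intro sum.cong) (auto simp: served_eq_card A_def)
  also have "\<dots> = card (Sigma C A)"
    using finC finA by simp
  also have "\<dots> \<le> card {1..N}"
  proof (rule card_inj_on_le)
    show "inj_on (\<lambda>(p, r, n). n) (Sigma C A)"
    proof (rule inj_onI)
      fix x y assume xy: "x \<in> Sigma C A" "y \<in> Sigma C A"
        and eq: "(\<lambda>(p, r, n). n) x = (\<lambda>(p, r, n). n) y"
      obtain k u r n where x: "x = ((k, u), r, n)" by (metis prod.exhaust)
      obtain k' u' r' where y: "y = ((k', u'), r', n)" using eq x by (metis prod.exhaust case_prod_conv)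
      have "u = s k r n" "u' = s k' r' n" "n \<in> {1..N}" "r \<in> {1..NRF}" "r' \<in> {1..NRF}"
          "(k, u) \<in> C" "(k', u') \<in> C"
        using xy by (auto simp: A_def x y)
      \<comment> \<open>Once cell and chain agree, the users agree too, both being the entry
        \<open>s k r n\<close>.\<close>
      then show "x = y"
        using feasible_clique_slot_unique[OF s C, of n r r' k k'] by (auto simp: x y)
    qed
  qed (auto simp: A_def)
  finally show ?thesis by simp
qed

lemma feasible_clique_deficit:
  assumes "feasible K U N NRF E d s" and "C \<subseteq> nodes K U" and "clique C E"
  shows "int (demand d C) - int N \<le> (\<Sum>(k, u)\<in>C. int (d k u) - int (served N NRF s k u))"
proof -
  have "(\<Sum>(k, u)\<in>C. int (d k u) - int (served N NRF s k u))
      = int (demand d C) - int (\<Sum>(k, u)\<in>C. served N NRF s k u)"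
    by (simp add: demand_def case_prod_unfold sum_subtractf)
  with feasible_clique_served_le[OF assms] show ?thesis by linarith
qed

text \<open>An invariant of the algorithm for an abstract weight \<open>f\<close>. The two
  inclusions make each clique of the current graph a clique of the original one, so that the bound
  on \<open>f\<close> applies to it.\<close>

lemma reachable_le_sum_removed:
  fixes f :: "nat \<times> nat \<Rightarrow> int"
  assumes "reachable N d V\<^sub>0 E\<^sub>0 V E t" and "finite V\<^sub>0"
    and f: "\<And>C. C \<subseteq> V\<^sub>0 \<Longrightarrow> clique C E\<^sub>0 \<Longrightarrow> int (demand d C) - int N \<le> sum f C"
  shows "V \<subseteq> V\<^sub>0 \<and> E \<subseteq> E\<^sub>0 \<and> t \<le> sum f (V\<^sub>0 - V)"
  using assms(1)
proof induction
  case start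
  show ?case by simp
next
  case (remove V E t C)
  then have C: "C \<subseteq> V" "clique C E" and V: "V \<subseteq> V\<^sub>0" and E: "E \<subseteq> E\<^sub>0"
    by (auto simp: removable_clique_def maximal_clique_def)
  have "sum f (V\<^sub>0 - (V - C)) = sum f ((V\<^sub>0 - V) \<union> C)"
    using C(1) V by (intro arg_cong[of _ _ "sum f"]) auto
  \<comment> \<open>\<open>C\<close> consists of nodes still present, hence is disjoint from those
    removed earlier.\<close>
  also have "\<dots> = sum f (V\<^sub>0 - V) + sum f C"
    using C(1) V \<open>finite V\<^sub>0\<close> by (intro sum.union_disjoint) (auto intro: finite_subset)
  finally have "sum f (V\<^sub>0 - (V - C)) = sum f (V\<^sub>0 - V) + sum f C" .
  moreover have "int (demand d C) - int N \<le> sum f C"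
    using C V E by (intro f) (blast, unfold clique_def, blast)
  ultimately show ?case using remove V E by auto
qed

theorem proposition3:
  fixes K U N NRF :: nat
    and E :: "(nat \<times> nat) set set"
    and d :: "nat \<Rightarrow> nat \<Rightarrow> nat"
    and lb :: int
  assumes "K > 0" and "U > 0" and "N > 0" and "NRF > 0"
    and "E \<subseteq> [nodes K U]\<^bsup>2\<^esup>"
    and "\<And>k u. k \<in> {1..K} \<Longrightarrow> u \<in> {1..U} \<Longrightarrow> d k u \<le> N"
    and "\<And>k. k \<in> {1..K} \<Longrightarrow> (\<Sum>u = 1..U. d k u) = NRF * N"
    and "lower_bound_output N d (nodes K U) E lb"
  shows "optimal_value K U N NRF E d \<ge> lb"
proof -
  obtain s where s: "feasible K U N NRF E d s"
    and opt: "objective K U N NRF d s = optimal_value K U N NRF E d"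
    using optimal_value_attained by blast
  \<comment> \<open>The unmet demand of each node under an optimal scheduling; its total is the
    optimal value.\<close>
  define f where "f = (\<lambda>(k, u). int (d k u) - int (served N NRF s k u))"
  obtain V E' where "reachable N d (nodes K U) E V E' lb"
    using assms(8) by (auto simp: lower_bound_output_def)
  moreover have fin: "finite (nodes K U)"
    by (simp add: nodes_def)
  ultimately have "lb \<le> sum f (nodes K U - V)"
    using feasible_clique_deficit[OF s] reachable_le_sum_removed[where f = f]
    unfolding f_def by blast
  \<comment> \<open>Nodes that were never removed add nonnegative terms, since service never exceeds
    demand.\<close>
  also have "\<dots> \<le> sum f (nodes K U)"
    using s fin by (intro sum_mono2) (auto simp: f_def feasible_def nodes_def)
  also have "\<dots> = optimal_value K U N NRF E d"
    by (simp add: f_def objective_def flip: opt)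
  finally show ?thesis .
qed

end
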